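(* Let $\varepsilon=\{\varepsilon_n\}_{n\ge 0}$ be a sequence of positive numbers tending to zero with $$\sum_{n=1}^\infty \frac{\varepsilon_n}{n}<\infty .$$ Then for every increasing continuous function $\omega$ on $[0,\infty)$ with $\omega(0)=0$ there exists a homeomorphism $h$ of the circle $T$ onto itself such that $f\circ h\in A_\varepsilon(T)$ for all $f\in H^\omega(T)$.
   Context: $T=\mathbb{R}/2\pi\mathbb{Z}$ is the circle. The Fourier coefficients of an integrable function $x$ on $T$ are $\widehat{x}(k)=\frac{1}{2\pi}\int_T x(t)e^{-ikt}\,dt$, $k\in\mathbb{Z}$. For a positive sequence $\varepsilon=\{\varepsilon_n\}$ tending to zero, $$A_\varepsilon(T)=\Big\{x:\ \|x\|_{A_\varepsilon}=\sum_{k\in\mathbb{Z}}|\widehat{x}(k)|\,\varepsilon_{|k|}<\infty\Big\}.$$ For an increasing continuous function $\omega$ on $[0,\infty)$ with $\omega(0)=0$, $H^\omega(T)$ denotes the class of real-valued functions $f$ on $T$ with $\omega(\delta,f)=O(\omega(\delta))$ as $\delta\to 0^+$, where $\omega(\delta,f)=\sup_{|t_1-t_2|<\delta}|f(t_1)-f(t_2)|$. *)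

theory Defs
  imports "HOL-Analysis.Analysis"
begin

text \<open>
  The circle \<open>T = \<real>/2\<pi>\<int>\<close> is represented by the unit circle \<open>sphere 0 1\<close> of the complex plane, the
  class of \<open>t\<close> being identified with the point \<open>cis t\<close>. A function on \<open>T\<close> is thus a
  function on \<^typ>\<open>complex\<close> of which only the values on the unit circle matter.
\<close>

abbreviation circle :: "complex set" where
  "circle \<equiv> sphere 0 1"

definition circle_integrable :: "(complex \<Rightarrow> complex) \<Rightarrow> bool" where
  "circle_integrable x \<longleftrightarrow> set_integrable lebesgue {0..2*pi} (\<lambda>t. x (cis t))"

definition fourier_coeff :: "(complex \<Rightarrow> complex) \<Rightarrow> int \<Rightarrow> complex" where
  "fourier_coeff x k =
     1 / (2 * pi) * (LINT t:{0..2*pi}|lebesgue. x (cis t) * exp (- \<i> * of_int k * of_real t))"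

definition A_space :: "(nat \<Rightarrow> real) \<Rightarrow> (complex \<Rightarrow> complex) set" where
  "A_space \<epsilon> = {x. circle_integrable x \<and>
     (\<lambda>k::int. cmod (fourier_coeff x k) * \<epsilon> (nat \<bar>k\<bar>)) summable_on UNIV}"

text \<open>
  Ranging over all real representatives \<open>t1\<close>, \<open>t2\<close> amounts to measuring \<open>\<bar>t1 - t2\<bar>\<close> as arc length
  on the circle. The supremum is extended real, so it is \<open>\<infinity>\<close> where the oscillation is unbounded.
\<close>

definition modulus_of_continuity :: "real \<Rightarrow> (complex \<Rightarrow> real) \<Rightarrow> ereal" where
  "modulus_of_continuity \<delta> f =
     (SUP (t1, t2) \<in> {(t1, t2). \<bar>t1 - t2\<bar> < \<delta>}. ereal \<bar>f (cis t1) - f (cis t2)\<bar>)"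

text \<open>The Landau symbol is spelled out because the left-hand side is extended real.\<close>

definition H_class :: "(real \<Rightarrow> real) \<Rightarrow> (complex \<Rightarrow> real) set" where
  "H_class \<omega> =
     {f. \<exists>C::real. \<forall>\<^sub>F \<delta> in at_right 0. modulus_of_continuity \<delta> f \<le> ereal (C * \<omega> \<delta>)}"

end

theory Submission
  imports Defs
begin

text \<open>
  A function \<open>f\<close> with a poor modulus of continuity is improved by a change of variable \<open>h\<close> that is
  almost constant most of the time. If \<open>f \<circ> h\<close> is a step function with \<open>m\<close> jumps up to an error \<open>E\<close> in
  mean, then its \<open>k\<close>-th Fourier coefficient is \<open>O(m / \<bar>k\<bar> + E)\<close>. So it suffices that \<open>h\<close> has, for each
  \<open>N\<close>, such an approximation with a number of jumps depending on \<open>N\<close> only and an error that is as small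
  as one likes. This can hold for all \<open>f\<close> in the class at once, because the error depends on \<open>f\<close> only
  through its bound and its modulus of continuity.
  
  Such an \<open>h\<close> is built by iterating the operator \<open>refine\<close>. It cuts the interval into halves, and
  each half into two parts: a short part of relative length \<open>\<eta>\<close> over which \<open>h\<close> makes almost its whole increase,
  and a long part in which \<open>h\<close> moves very little; then it inserts the next iterate into every part. The
  limit is a homeomorphism because exchanging domain and range exchanges the two splitting ratios, so
  that its inverse is a limit of the same kind (\<open>limit_path_inverse\<close>). The Fourier estimate follows
  the same recursion instead of listing the jumps: gluing two rescaled copies of a path doubles the
  constant in front of \<open>1 / \<bar>k\<bar>\<close> and leaves the error unchanged (\<open>decays_glue\<close>), and the error is produced
  at a single level (\<open>decays_concentrated\<close>). The outcome is
  \<open>\<bar>c_k\<bar> \<le> 4^N * 4 M / \<bar>k\<bar> + M \<eta>_N + C \<omega>(8 \<eta>_N)\<close>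
  for all sufficiently large \<open>N\<close>.
  
  It remains to choose \<open>\<eta>\<close>. As \<open>\<Sum> \<epsilon>_n / n\<close> converges, there is a sequence \<open>L\<close> tending to infinity with
  \<open>\<Sum> L_n \<epsilon>_n / n\<close> still convergent (\<open>du_Bois_Reymond\<close>). If \<open>K_N\<close> is such that \<open>4^N \<le> L_k\<close> for
  \<open>k \<ge> K_N\<close>, and \<open>\<eta>_N\<close> and \<open>\<omega>(8 \<eta>_N)\<close> are at most \<open>1 / K_(N+1)\<close>, then using the level \<open>N\<close> for
  \<open>K_N \<le> \<bar>k\<bar> < K_(N+1)\<close> gives coefficients \<open>O((1 + L_k) / \<bar>k\<bar>)\<close>, which is summable against \<open>\<epsilon>\<close>.
\<close>

section \<open>Gluing two rescaled copies of a path\<close>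

definition unit_path :: "(real \<Rightarrow> real) \<Rightarrow> bool" where
  "unit_path g \<longleftrightarrow> continuous_on {0..1} g \<and> g ` {0..1} \<subseteq> {0..1} \<and> g 0 = 0 \<and> g 1 = 1"

text \<open>
  The graph of \<open>g\<close> is squeezed into the rectangles \<open>[0, p] \<times> [0, q]\<close> and \<open>[p, 1] \<times> [q, 1]\<close>.
\<close>

definition glue :: "real \<Rightarrow> real \<Rightarrow> (real \<Rightarrow> real) \<Rightarrow> real \<Rightarrow> real" where
  "glue p q g t = (if t \<le> p then q * g (t / p) else q + (1 - q) * g ((t - p) / (1 - p)))"

lemma unit_path_range: "unit_path g \<Longrightarrow> t \<in> {0..1} \<Longrightarrow> 0 \<le> g t \<and> g t \<le> 1"
  by (auto simp: unit_path_def image_subset_iff)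

lemma unit_interval_rescale:
  fixes p t :: real
  assumes "0 < p" "p < 1" "t \<in> {0..1}"
  shows "t \<le> p \<Longrightarrow> t / p \<in> {0..1}" "p \<le> t \<Longrightarrow> (t - p) / (1 - p) \<in> {0..1}"
  using assms by (auto simp: field_simps)

lemma glue_range:
  assumes "0 < p" "p < 1" "0 < q" "q < 1" "g ` {0..1} \<subseteq> {0..1}" "t \<in> {0..1}"
  shows "t \<le> p \<Longrightarrow> glue p q g t \<in> {0..q}" "p < t \<Longrightarrow> glue p q g t \<in> {q..1}"
proof -
  assume "t \<le> p"
  then have "g (t / p) \<in> {0..1}"
    using unit_interval_rescale(1)[of p t] assms by blast
  then show "glue p q g t \<in> {0..q}"
    using \<open>t \<le> p\<close> assms(3) by (auto simp: glue_def mult_left_le)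
next
  assume "p < t"
  then have *: "g ((t - p) / (1 - p)) \<in> {0..1}"
    using unit_interval_rescale(2)[of p t] assms by fastforce
  have "(1 - q) * g ((t - p) / (1 - p)) \<le> 1 - q" "0 \<le> (1 - q) * g ((t - p) / (1 - p))"
    using * assms by (auto intro: mult_left_le)
  then show "glue p q g t \<in> {q..1}"
    using \<open>p < t\<close> by (simp add: glue_def)
qed

lemma unit_path_glue:
  assumes "0 < p" "p < 1" "0 < q" "q < 1" "unit_path g"
  shows "unit_path (glue p q g)"
proof -
  have g: "continuous_on {0..1} g" "g ` {0..1} \<subseteq> {0..1}" "g 0 = 0" "g 1 = 1"
    using assms(5) by (auto simp: unit_path_def)
  have "continuous_on {0..1} (glue p q g)"
    unfolding glue_def
  proof (rule continuous_on_cases_le)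
    show "continuous_on {t \<in> {0..1}. t \<le> p} (\<lambda>t. q * g (t / p))"
      by (intro continuous_intros continuous_on_compose2[OF g(1)])
         (use assms in \<open>auto simp: field_simps\<close>)
    show "continuous_on {t \<in> {0..1}. p \<le> t} (\<lambda>t. q + (1 - q) * g ((t - p) / (1 - p)))"
      by (intro continuous_intros continuous_on_compose2[OF g(1)])
         (use assms in \<open>auto simp: field_simps\<close>)
  qed (use g assms in \<open>auto intro!: continuous_intros\<close>)
  moreover have "glue p q g t \<in> {0..1}" if "t \<in> {0..1}" for t
  proof (cases "t \<le> p")
    case True
    then show ?thesis
      using glue_range(1)[OF assms(1-4) g(2) that] assms(4) by simp
  next
    case False
    then show ?thesis
      using glue_range(2)[OF assms(1-4) g(2) that] assms(3) by simp
  qed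
  moreover have "glue p q g 0 = 0" "glue p q g 1 = 1"
    using g(3,4) assms(1,2) by (simp_all add: glue_def)
  ultimately show ?thesis
    unfolding unit_path_def by blast
qed

lemma glue_diff_le:
  assumes "0 < p" "p < 1" "0 < q" "q < 1" "t \<in> {0..1}"
    and "\<And>s. s \<in> {0..1} \<Longrightarrow> \<bar>a s - b s\<bar> \<le> e"
  shows "\<bar>glue p q a t - glue p q b t\<bar> \<le> max q (1 - q) * e"
proof -
  have "0 \<le> e"
    using assms(6)[of 0] by auto
  consider "t \<le> p" | "p < t" by linarith
  then show ?thesis
  proof cases
    case 1
    then have "\<bar>glue p q a t - glue p q b t\<bar> = q * \<bar>a (t/p) - b (t/p)\<bar>"
      using assms by (simp add: glue_def abs_mult flip: right_diff_distrib)
    also have "\<dots> \<le> max q (1 - q) * e"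
      using assms(3,6) unit_interval_rescale(1)[OF assms(1,2,5) 1] by (intro mult_mono) simp_all
    finally show ?thesis .
  next
    case 2
    then have "\<bar>glue p q a t - glue p q b t\<bar>
        = (1 - q) * \<bar>a ((t - p) / (1 - p)) - b ((t - p) / (1 - p))\<bar>"
      using assms by (simp add: glue_def abs_mult flip: right_diff_distrib)
    also have "\<dots> \<le> max q (1 - q) * e"
      using assms(4,6) unit_interval_rescale(2)[OF assms(1,2,5)] 2 by (intro mult_mono) simp_all
    finally show ?thesis .
  qed
qed

text \<open>
  Reflecting the two rectangles in the diagonal exchanges \<open>p\<close> and \<open>q\<close>, so gluing commutes with
  taking inverses once the ratios are swapped.
\<close>

lemma glue_inverse:
  assumes "0 < p" "p < 1" "0 < q" "q < 1" "unit_path g" "unit_path k"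
    and kg: "\<And>s. s \<in> {0..1} \<Longrightarrow> k (g s) = s" and t: "t \<in> {0..1}"
  shows "glue q p k (glue p q g t) = t"
proof (cases "t \<le> p")
  case True
  define s where "s = t / p"
  have s: "s \<in> {0..1}" "t = p * s"
    using unit_interval_rescale(1)[OF assms(1,2) t True] assms(1) by (auto simp: s_def)
  have "glue p q g t = q * g s"
    using True by (simp add: glue_def s_def)
  moreover have "q * g s \<le> q"
    using unit_path_range[OF assms(5) s(1)] assms(3) by (simp add: mult_left_le)
  ultimately show ?thesis
    using s(2) kg[OF s(1)] assms(3) by (simp add: glue_def)
next
  case False
  define s where "s = (t - p) / (1 - p)"
  have s: "s \<in> {0..1}" "t = p + (1 - p) * s" "0 < s"
    using unit_interval_rescale(2)[of p t] False t assms(1,2) by (auto simp: s_def)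
  have "k 0 = 0"
    using assms(6) by (simp add: unit_path_def)
  then have "g s \<noteq> 0"
    using kg[OF s(1)] s(3) by auto
  then have "0 < g s"
    using unit_path_range[OF assms(5) s(1)] by linarith
  then have above: "\<not> q + (1 - q) * g s \<le> q"
    using assms(4) by (simp add: not_le)
  have "glue p q g t = q + (1 - q) * g s"
    using False by (simp add: glue_def s_def)
  moreover have "(q + (1 - q) * g s - q) / (1 - q) = g s"
    using assms(4) by simp
  ultimately have "glue q p k (glue p q g t) = p + (1 - p) * k (g s)"
    using above unfolding glue_def[of q p k] by presburger
  also have "\<dots> = t"
    unfolding kg[OF s(1)] by (rule s(2)[symmetric])
  finally show ?thesis .
qed

text \<open>
  The outer halving bisects both axes at once. It makes the operator a contraction with factor
  \<open>1/2\<close> whatever the ratios \<open>p\<close> and \<open>q\<close> are; without it, ratios \<open>q = 1 - p\<close> with \<open>p\<close> summable over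
  the levels would produce a limit that is constant on an interval.
\<close>

definition refine :: "real \<Rightarrow> real \<Rightarrow> (real \<Rightarrow> real) \<Rightarrow> real \<Rightarrow> real" where
  "refine p q g = glue (1/2) (1/2) (glue p q g)"

lemma unit_path_refine:
  "0 < p \<Longrightarrow> p < 1 \<Longrightarrow> 0 < q \<Longrightarrow> q < 1 \<Longrightarrow> unit_path g \<Longrightarrow> unit_path (refine p q g)"
  by (simp add: refine_def unit_path_glue)

lemma refine_contracts:
  assumes "0 < p" "p < 1" "0 < q" "q < 1" "t \<in> {0..1}"
    and ab: "\<And>s. s \<in> {0..1} \<Longrightarrow> \<bar>a s - b s\<bar> \<le> e"
  shows "\<bar>refine p q a t - refine p q b t\<bar> \<le> e / 2"
proof -
  have "0 \<le> e"
    using ab[of 0] by auto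
  have "\<bar>glue p q a s - glue p q b s\<bar> \<le> e" if "s \<in> {0..1}" for s
    by (rule order_trans[OF glue_diff_le[OF assms(1-4) that ab]])
       (use \<open>0 \<le> e\<close> assms in \<open>auto intro: mult_left_le_one_le\<close>)
  from glue_diff_le[of "1/2" "1/2", OF _ _ _ _ assms(5) this] show ?thesis
    by (simp add: refine_def)
qed

lemma refine_inverse:
  assumes "0 < p" "p < 1" "0 < q" "q < 1" "unit_path g" "unit_path k"
    and "\<And>s. s \<in> {0..1} \<Longrightarrow> k (g s) = s" and "t \<in> {0..1}"
  shows "refine q p k (refine p q g t) = t"
proof -
  have inv: "glue q p k (glue p q g s) = s" if "s \<in> {0..1}" for s
    by (rule glue_inverse) (fact assms that)+
  have paths: "unit_path (glue p q g)" "unit_path (glue q p k)"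
    using assms(1-6) by (simp_all add: unit_path_glue)
  show ?thesis
    unfolding refine_def
    by (rule glue_inverse[OF _ _ _ _ paths inv assms(8)]) simp_all
qed

section \<open>The limit of infinitely many refinements\<close>

text \<open>
  The ratios are consumed from the outside inwards, the outermost level being \<open>n\<close>. Keeping the
  starting level as a parameter makes the limits for different \<open>n\<close> satisfy a functional equation.
\<close>

primrec refinement :: "(nat \<Rightarrow> real) \<Rightarrow> (nat \<Rightarrow> real) \<Rightarrow> nat \<Rightarrow> nat \<Rightarrow> real \<Rightarrow> real" where
  "refinement p q 0 n = (\<lambda>t. t)"
| "refinement p q (Suc m) n = refine (p n) (q n) (refinement p q m (Suc n))"

locale splitting_ratios =
  fixes p q :: "nat \<Rightarrow> real"
  assumes p: "0 < p n" "p n < 1" and q: "0 < q n" "q n < 1"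
begin

lemma swap: "splitting_ratios q p"
  by unfold_locales (auto intro: p q)

lemma unit_path_refinement: "unit_path (refinement p q m n)"
proof (induction m arbitrary: n)
  case 0
  then show ?case by (auto simp: unit_path_def)
next
  case (Suc m)
  then show ?case by (simp add: unit_path_refine p q)
qed

lemma refinement_inverse:
  "t \<in> {0..1} \<Longrightarrow> refinement q p m n (refinement p q m n t) = t"
proof (induction m arbitrary: n t)
  case (Suc m)
  interpret sw: splitting_ratios q p by (rule swap)
  show ?case
    unfolding refinement.simps
    by (intro refine_inverse p q unit_path_refinement sw.unit_path_refinement Suc)
qed simp

text \<open>
  Two paths that share their outer \<open>m\<close> levels differ only by what is fed into \<open>m\<close> contractions, and
  any two unit paths are at distance at most \<open>1\<close>.
\<close>

lemma refinement_Cauchy: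
  "t \<in> {0..1} \<Longrightarrow> \<bar>refinement p q (m + j) n t - refinement p q m n t\<bar> \<le> (1/2) ^ m"
proof (induction m arbitrary: n t)
  case 0
  then show ?case
    using unit_path_range[OF unit_path_refinement 0, of j n] by (auto simp: abs_le_iff)
next
  case (Suc m)
  then show ?case
    using refine_contracts[OF p q Suc.prems Suc.IH] by simp
qed

definition limit_path :: "nat \<Rightarrow> real \<Rightarrow> real" where
  "limit_path n t = lim (\<lambda>m. refinement p q m n t)"

lemma uniform_limit_refinement:
  "uniform_limit {0..1} (\<lambda>m. refinement p q m n) (limit_path n) sequentially"
proof -
  have "uniformly_Cauchy_on {0..1} (\<lambda>m. refinement p q m n)"
  proof (rule uniformly_Cauchy_onI')
    fix e :: real assume "e > 0"
    then obtain M where M: "(1/2) ^ M < e"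
      using real_arch_pow_inv[of e "1/2"] by auto
    show "\<exists>M. \<forall>t\<in>{0..1}. \<forall>m\<ge>M. \<forall>j>m. dist (refinement p q m n t) (refinement p q j n t) < e"
    proof (intro exI[of _ M] ballI allI impI)
      fix t :: real and m j :: nat assume "t \<in> {0..1}" "M \<le> m" "m < j"
      have "dist (refinement p q m n t) (refinement p q j n t) \<le> (1/2) ^ m"
        using refinement_Cauchy[OF \<open>t \<in> _\<close>, of m "j - m" n] \<open>m < j\<close>
        by (simp add: dist_real_def abs_minus_commute)
      also have "\<dots> \<le> (1/2) ^ M"
        using \<open>M \<le> m\<close> by (intro power_decreasing) auto
      finally show "dist (refinement p q m n t) (refinement p q j n t) < e"
        using M by linarith
    qed
  qed
  then show ?thesis
    unfolding limit_path_def
    using Cauchy_uniformly_convergent uniformly_convergent_uniform_limit_iff by blast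
qed

lemma refinement_tendsto: "t \<in> {0..1} \<Longrightarrow> (\<lambda>m. refinement p q m n t) \<longlonglongrightarrow> limit_path n t"
  by (rule tendsto_uniform_limitI[OF uniform_limit_refinement])

lemma unit_path_limit: "unit_path (limit_path n)"
proof -
  have "continuous_on {0..1} (limit_path n)"
    by (rule uniform_limit_theorem[OF _ uniform_limit_refinement])
       (use unit_path_refinement in \<open>auto simp: unit_path_def\<close>)
  moreover have "limit_path n t \<in> {0..1}" if "t \<in> {0..1}" for t
    by (rule Lim_in_closed_set[OF _ _ _ refinement_tendsto[OF that]])
       (use unit_path_range[OF unit_path_refinement that] in auto)
  moreover have "limit_path n t = t" if "t = 0 \<or> t = 1" for t
  proof -
    have "refinement p q m n t = t" for m
      using unit_path_refinement[of m n] that by (auto simp: unit_path_def)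
    then show ?thesis by (simp add: limit_path_def)
  qed
  ultimately show ?thesis by (auto simp: unit_path_def)
qed

lemma limit_path_refine:
  assumes "t \<in> {0..1}"
  shows "limit_path n t = refine (p n) (q n) (limit_path (Suc n)) t"
proof (rule LIMSEQ_unique)
  show "(\<lambda>m. refinement p q (Suc m) n t) \<longlonglongrightarrow> limit_path n t"
    using refinement_tendsto[OF assms] by (rule LIMSEQ_Suc)
  have glue: "(\<lambda>m. glue a b (g m) s) \<longlonglongrightarrow> glue a b l s"
    if "0 < a" "a < 1" "s \<in> {0..1}" "\<And>s. s \<in> {0..1} \<Longrightarrow> (\<lambda>m. g m s) \<longlonglongrightarrow> l s"
    for a b s :: real and g l
    unfolding glue_def using unit_interval_rescale[OF that(1-3)] that(4)
    by (auto intro!: tendsto_intros)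
  show "(\<lambda>m. refinement p q (Suc m) n t) \<longlonglongrightarrow> refine (p n) (q n) (limit_path (Suc n)) t"
    unfolding refinement.simps refine_def
    by (intro glue refinement_tendsto) (use p assms in auto)
qed

text \<open>
  At every finite stage the path with swapped ratios is the inverse. Both sequences converge
  uniformly, so this passes to the limit. It yields the injectivity of the limit, which a uniform
  limit of increasing functions need not have.
\<close>

lemma limit_path_inverse:
  assumes "t \<in> {0..1}"
  shows "splitting_ratios.limit_path q p n (limit_path n t) = t"
proof (rule LIMSEQ_unique)
  interpret sw: splitting_ratios q p by (rule swap)
  let ?y = "\<lambda>m. refinement p q m n t"
  have y: "?y m \<in> {0..1}" for m
    using unit_path_range[OF unit_path_refinement assms] by auto
  have lim: "limit_path n t \<in> {0..1}"
    using unit_path_range[OF unit_path_limit assms] by auto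
  have "continuous_on {0..1} (sw.limit_path n)"
    using sw.unit_path_limit by (simp add: unit_path_def)
  then have A: "(\<lambda>m. sw.limit_path n (?y m)) \<longlonglongrightarrow> sw.limit_path n (limit_path n t)"
    using continuous_on_tendsto_compose[OF _ refinement_tendsto[OF assms] lim] y by auto
  show "(\<lambda>m. sw.limit_path n (?y m)) \<longlonglongrightarrow> sw.limit_path n (limit_path n t)" by (rule A)
  show "(\<lambda>m. sw.limit_path n (?y m)) \<longlonglongrightarrow> t"
  proof (rule metric_LIMSEQ_I)
    fix e :: real assume "e > 0"
    from uniform_limitD[OF sw.uniform_limit_refinement this, of n]
    obtain M where M: "\<And>m s. m \<ge> M \<Longrightarrow> s \<in> {0..1} \<Longrightarrow>
        dist (refinement q p m n s) (sw.limit_path n s) < e"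
      unfolding eventually_sequentially by blast
    show "\<exists>M. \<forall>m\<ge>M. dist (sw.limit_path n (?y m)) t < e"
      using M[OF _ y] refinement_inverse[OF assms] by (metis dist_commute)
  qed
qed

lemma inj_on_limit_path: "inj_on (limit_path n) {0..1}"
  using limit_path_inverse by (metis inj_on_inverseI)

end

section \<open>Oscillatory integrals along glued paths\<close>

lemma integral_rescale_unit:
  fixes u :: "real \<Rightarrow> complex"
  assumes "a < b" "continuous_on {a..b} u"
  shows "integral {a..b} u = (b - a) *\<^sub>R integral {0..1} (\<lambda>s. u (a + (b - a) * s))"
proof -
  have "((\<lambda>s. (b - a) *\<^sub>R u (a + (b - a) * s)) has_integral
      integral {a + (b - a) * 0..a + (b - a) * 1} u) {0..1}"
  proof (rule has_integral_substitution[where c = a and d = b])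
    have "a + (b - a) * s \<in> {a..b}" if "s \<in> {0..1}" for s
    proof -
      have "(b - a) * s \<le> (b - a) * 1"
        using that assms(1) by (intro mult_left_mono) auto
      moreover have "0 \<le> (b - a) * s"
        using that assms(1) by simp
      ultimately show ?thesis
        by (simp add: algebra_simps del: mult_le_cancel_left_pos)
    qed
    then show "(\<lambda>s. a + (b - a) * s) ` {0..1} \<subseteq> {a..b}" by blast
  qed (use assms in \<open>auto intro!: derivative_eq_intros\<close>)
  from integral_unique[OF this] show ?thesis
    by simp
qed

lemma norm_integral_cis_le:
  assumes "a \<le> b" "\<xi> \<noteq> 0"
  shows "cmod (integral {a..b} (\<lambda>t. cis (\<xi> * t))) \<le> 2 / \<bar>\<xi>\<bar>"
proof -
  define P where "P t = cis (\<xi> * t) / (\<i> * of_real \<xi>)" for t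
  have "((\<lambda>t. cis (\<xi> * t)) has_integral (P b - P a)) {a..b}"
    unfolding P_def cis_conv_exp
    by (rule fundamental_theorem_of_calculus[OF assms(1)])
       (use assms(2) in \<open>auto intro!: derivative_eq_intros has_vector_derivative_real_field simp: field_simps\<close>)
  then have "integral {a..b} (\<lambda>t. cis (\<xi> * t)) = P b - P a"
    by (rule integral_unique)
  also have "cmod \<dots> \<le> cmod (P b) + cmod (P a)"
    by (rule norm_triangle_ineq4)
  also have "\<dots> = 2 / \<bar>\<xi>\<bar>"
    by (simp add: P_def norm_divide norm_mult)
  finally show ?thesis .
qed

text \<open>
  The class is chosen to be stable under restriction to a subinterval of \<open>{0..1}\<close> followed by
  rescaling to \<open>{0..1}\<close>, an operation that can only reduce oscillation. Therefore an estimate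
  uniform over the class survives gluing.
\<close>

definition tame :: "real \<Rightarrow> real \<Rightarrow> real \<Rightarrow> (real \<Rightarrow> real) \<Rightarrow> bool" where
  "tame M \<delta> D F \<longleftrightarrow> continuous_on {0..1} F \<and> (\<forall>x\<in>{0..1}. \<bar>F x\<bar> \<le> M) \<and>
     (\<forall>x\<in>{0..1}. \<forall>y\<in>{0..1}. \<bar>x - y\<bar> \<le> \<delta> \<longrightarrow> \<bar>F x - F y\<bar> \<le> D)"

lemma tame_affine:
  assumes "tame M \<delta> D F" "0 \<le> a" "0 < q" "a + q \<le> 1"
  shows "tame M \<delta> D (\<lambda>x. F (a + q * x))"
proof -
  have unit: "a + q * x \<in> {0..1}" if "x \<in> {0..1}" for x
  proof -
    have "q * x \<le> q" "0 \<le> q * x"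
      using that assms(3) by (simp_all add: mult_left_le)
    then show ?thesis
      using assms(2,4) by (intro atLeastAtMost_iff[THEN iffD2] conjI) linarith+
  qed
  have "continuous_on {0..1} (\<lambda>x. F (a + q * x))"
    by (rule continuous_on_compose2[of "{0..1}" F])
       (use assms(1) unit in \<open>auto simp: tame_def intro!: continuous_intros\<close>)
  moreover have "\<bar>F (a + q * x) - F (a + q * y)\<bar> \<le> D"
    if "x \<in> {0..1}" "y \<in> {0..1}" "\<bar>x - y\<bar> \<le> \<delta>" for x y
  proof -
    have "\<bar>(a + q * x) - (a + q * y)\<bar> = q * \<bar>x - y\<bar>"
      using assms(3) by (simp add: abs_mult flip: right_diff_distrib)
    also have "\<dots> \<le> 1 * \<bar>x - y\<bar>"
      using assms by (intro mult_right_mono) auto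
    finally have "\<bar>(a + q * x) - (a + q * y)\<bar> \<le> \<delta>"
      using that(3) by simp
    then show ?thesis
      using assms(1) unit[OF that(1)] unit[OF that(2)] unfolding tame_def by blast
  qed
  ultimately show ?thesis
    using assms(1) unit unfolding tame_def by blast
qed

text \<open>
  A decaying term plus a floor \<open>E\<close>. All real frequencies are admitted because rescaling a piece of
  the path multiplies the frequency by the length of the piece.
\<close>

definition decays :: "real \<Rightarrow> real \<Rightarrow> real \<Rightarrow> (real \<Rightarrow> real) \<Rightarrow> real \<Rightarrow> real \<Rightarrow> bool" where
  "decays M \<delta> D g A E \<longleftrightarrow> (\<forall>F \<xi>. tame M \<delta> D F \<longrightarrow> \<xi> \<noteq> 0 \<longrightarrow>
     cmod (integral {0..1} (\<lambda>t. of_real (F (g t)) * cis (\<xi> * t))) \<le> A / \<bar>\<xi>\<bar> + E)"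

lemma tame_compose_continuous:
  assumes "tame M \<delta> D F" "unit_path g"
  shows "continuous_on {0..1} (\<lambda>t. complex_of_real (F (g t)) * cis (\<xi> * t))"
proof -
  have "continuous_on {0..1} (\<lambda>t. F (g t))"
    by (rule continuous_on_compose2[of "{0..1}" F])
       (use assms in \<open>auto simp: tame_def unit_path_def\<close>)
  then show ?thesis
    by (intro continuous_intros)
qed

text \<open>
  On a piece of length \<open>p\<close> the bound becomes \<open>p (A / (\<bar>\<xi>\<bar> p) + E) = A / \<bar>\<xi>\<bar> + p E\<close>: the decaying term
  does not see the length, while the floors are averaged. Hence the floor is not amplified, and
  \<open>A\<close> is multiplied by the number of pieces.
\<close>

lemma decays_glue:
  assumes p: "0 < p" "p < 1" and q: "0 < q" "q < 1"
    and g: "unit_path g" and dec: "decays M \<delta> D g A E"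
  shows "decays M \<delta> D (glue p q g) (2 * A) E"
  unfolding decays_def
proof (intro allI impI)
  fix F and \<xi> :: real assume F: "tame M \<delta> D F" and \<xi>: "\<xi> \<noteq> 0"
  define u where "u t = complex_of_real (F (glue p q g t)) * cis (\<xi> * t)" for t
  have cont: "continuous_on {0..1} u"
    unfolding u_def by (rule tame_compose_continuous[OF F unit_path_glue[OF p q g]])
  have piece: "cmod (integral {0..1} (\<lambda>s. of_real (F (a + b * g s)) * cis (\<xi> * c * s)))
      \<le> A / (\<bar>\<xi>\<bar> * c) + E" if "0 \<le> a" "0 < b" "a + b \<le> 1" "0 < c" for a b c
  proof -
    have "\<xi> * c \<noteq> 0" "\<bar>\<xi> * c\<bar> = \<bar>\<xi>\<bar> * c"
      using \<xi> that(4) by (simp_all add: abs_mult)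
    moreover have "cmod (integral {0..1} (\<lambda>s. of_real (F (a + b * g s)) * cis ((\<xi> * c) * s)))
        \<le> A / \<bar>\<xi> * c\<bar> + E"
      using dec[unfolded decays_def, rule_format, OF tame_affine[OF F that(1-3)] \<open>\<xi> * c \<noteq> 0\<close>] .
    ultimately show ?thesis by simp
  qed
  have "integral {0..p} u = p *\<^sub>R integral {0..1} (\<lambda>s. u (0 + (p - 0) * s))"
    using integral_rescale_unit[of 0 p u] p continuous_on_subset[OF cont] by auto
  also have "integral {0..1} (\<lambda>s. u (0 + (p - 0) * s))
      = integral {0..1} (\<lambda>s. of_real (F (0 + q * g s)) * cis (\<xi> * p * s))"
    by (rule integral_cong) (use p in \<open>auto simp: u_def glue_def mult_left_le mult_ac\<close>)
  finally have left: "cmod (integral {0..p} u) \<le> p * (A / (\<bar>\<xi>\<bar> * p) + E)"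
    using piece[of 0 q p] p q by simp
  have "integral {p..1} u = (1 - p) *\<^sub>R integral {0..1} (\<lambda>s. u (p + (1 - p) * s))"
    using integral_rescale_unit[of p 1 u] p continuous_on_subset[OF cont] by auto
  also have "integral {0..1} (\<lambda>s. u (p + (1 - p) * s))
      = integral {0..1} (\<lambda>s. cis (\<xi> * p) * (of_real (F (q + (1 - q) * g s)) * cis (\<xi> * (1 - p) * s)))"
  proof (rule integral_cong)
    fix s :: real assume s: "s \<in> {0..1}"
    have "glue p q g (p + (1 - p) * s) = q + (1 - q) * g s"
    proof (cases "s = 0")
      case True
      then show ?thesis
        using g p by (simp add: glue_def unit_path_def)
    next
      case False
      then have "0 < (1 - p) * s"
        using s p by simp
      then show ?thesis
        using p by (simp add: glue_def)
    qed
    moreover have "cis (\<xi> * (p + (1 - p) * s)) = cis (\<xi> * p) * cis (\<xi> * (1 - p) * s)"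
      by (simp add: cis_mult algebra_simps)
    ultimately show "u (p + (1 - p) * s)
        = cis (\<xi> * p) * (of_real (F (q + (1 - q) * g s)) * cis (\<xi> * (1 - p) * s))"
      by (simp add: u_def)
  qed
  finally have right: "cmod (integral {p..1} u) \<le> (1 - p) * (A / (\<bar>\<xi>\<bar> * (1 - p)) + E)"
    using piece[of q "1 - q" "1 - p"] p q by (simp add: norm_mult)
  have "integral {0..1} u = integral {0..p} u + integral {p..1} u"
    using p integrable_continuous_real[OF cont] by (simp add: Henstock_Kurzweil_Integration.integral_combine)
  then have "cmod (integral {0..1} u) \<le> p * (A / (\<bar>\<xi>\<bar> * p) + E) + (1 - p) * (A / (\<bar>\<xi>\<bar> * (1 - p)) + E)"
    using norm_triangle_ineq[of "integral {0..p} u" "integral {p..1} u"] left right by simp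
  also have "p * (A / (\<bar>\<xi>\<bar> * p) + E) = A / \<bar>\<xi>\<bar> + p * E"
    using p by (simp add: distrib_left)
  also have "(1 - p) * (A / (\<bar>\<xi>\<bar> * (1 - p)) + E) = A / \<bar>\<xi>\<bar> + (1 - p) * E"
    using p by (simp add: distrib_left)
  also have "A / \<bar>\<xi>\<bar> + p * E + (A / \<bar>\<xi>\<bar> + (1 - p) * E) = 2 * A / \<bar>\<xi>\<bar> + E"
    by (simp add: algebra_simps)
  finally show "cmod (integral {0..1} (\<lambda>t. of_real (F (glue p q g t)) * cis (\<xi> * t)))
      \<le> 2 * A / \<bar>\<xi>\<bar> + E"
    by (simp add: u_def)
qed

text \<open>
  With ratios \<open>\<eta>\<close> and \<open>1 - \<eta>\<close> the path moves by at most \<open>\<eta>\<close> during all but the proportion \<open>\<eta>\<close> of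
  the time. There \<open>F\<close> is within \<open>D\<close> of a constant, whose integral against the character is
  \<open>O(1 / \<bar>\<xi>\<bar>)\<close>; the remaining time contributes at most \<open>M \<eta>\<close>.
\<close>

lemma decays_concentrated:
  assumes \<eta>: "0 < \<eta>" "\<eta> < 1" and g: "unit_path g"
  shows "decays M \<eta> D (glue \<eta> (1 - \<eta>) g) (2 * M) (M * \<eta> + D)"
  unfolding decays_def
proof (intro allI impI)
  fix F and \<xi> :: real assume F: "tame M \<eta> D F" and \<xi>: "\<xi> \<noteq> 0"
  let ?g = "glue \<eta> (1 - \<eta>) g"
  have path: "unit_path ?g"
    using unit_path_glue \<eta> g by simp
  define u where "u t = complex_of_real (F (?g t)) * cis (\<xi> * t)" for t
  have cont: "continuous_on {0..1} u"
    unfolding u_def by (rule tame_compose_continuous[OF F path])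
  have M: "\<bar>F x\<bar> \<le> M" if "x \<in> {0..1}" for x
    using F that by (simp add: tame_def)
  have "0 \<le> D"
    using F \<eta> unfolding tame_def by (metis abs_ge_zero abs_zero atLeastAtMost_iff diff_self dual_order.trans less_eq_real_def zero_le_one)
  have left: "cmod (integral {0..\<eta>} u) \<le> M * (\<eta> - 0)"
  proof (rule integral_bound)
    show "continuous_on {0..\<eta>} u"
      by (rule continuous_on_subset[OF cont]) (use \<eta> in auto)
    show "cmod (u t) \<le> M" if "t \<in> {0..\<eta>}" for t
      using M unit_path_range[OF path, of t] that \<eta> by (simp add: u_def norm_mult)
  qed (use \<eta> in simp)
  define v where "v t = u t - of_real (F 1) * cis (\<xi> * t)" for t
  have contv: "continuous_on {\<eta>..1} v"
    unfolding v_def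
    by (intro continuous_intros continuous_on_subset[OF cont]) (use \<eta> in auto)
  have v: "cmod (integral {\<eta>..1} v) \<le> D * (1 - \<eta>)"
  proof (rule integral_bound[OF _ contv])
    fix t assume t: "t \<in> {\<eta>..1}"
    have "?g t \<in> {1 - \<eta>..1}"
    proof (cases "t = \<eta>")
      case True
      then show ?thesis
        using g \<eta> by (simp add: glue_def unit_path_def)
    next
      case False
      have "g ` {0..1} \<subseteq> {0..1}" using g by (simp add: unit_path_def)
      from glue_range(2)[OF \<eta> _ _ this, of "1 - \<eta>" t] show ?thesis
        using t \<eta> False by simp
    qed
    then have "\<bar>F (?g t) - F 1\<bar> \<le> D"
      using F \<eta> unfolding tame_def by auto
    moreover have "v t = of_real (F (?g t) - F 1) * cis (\<xi> * t)"
      by (simp add: v_def u_def algebra_simps)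
    ultimately show "cmod (v t) \<le> D"
      by (simp add: norm_mult del: of_real_diff)
  qed (use \<eta> in simp)
  have "integral {\<eta>..1} u = integral {\<eta>..1} (\<lambda>t. v t + of_real (F 1) * cis (\<xi> * t))"
    by (simp add: v_def)
  also have "\<dots> = integral {\<eta>..1} v + of_real (F 1) * integral {\<eta>..1} (\<lambda>t. cis (\<xi> * t))"
    by (subst integral_add) (auto intro!: integrable_continuous_real contv continuous_intros)
  finally have "cmod (integral {\<eta>..1} u)
      \<le> cmod (integral {\<eta>..1} v) + \<bar>F 1\<bar> * cmod (integral {\<eta>..1} (\<lambda>t. cis (\<xi> * t)))"
    using norm_triangle_ineq by (metis norm_mult norm_of_real)
  also have "\<dots> \<le> D * (1 - \<eta>) + M * (2 / \<bar>\<xi>\<bar>)"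
    by (intro add_mono mult_mono v M norm_integral_cis_le \<xi>) (use \<eta> M[of 1] in auto)
  also have "D * (1 - \<eta>) \<le> D"
    using \<open>0 \<le> D\<close> \<eta> by (simp add: mult_left_le)
  finally have right: "cmod (integral {\<eta>..1} u) \<le> D + M * (2 / \<bar>\<xi>\<bar>)" by simp
  have "integral {0..1} u = integral {0..\<eta>} u + integral {\<eta>..1} u"
    using \<eta> integrable_continuous_real[OF cont] by (simp add: Henstock_Kurzweil_Integration.integral_combine)
  then have "cmod (integral {0..1} u) \<le> M * \<eta> + (D + M * (2 / \<bar>\<xi>\<bar>))"
    using norm_triangle_ineq[of "integral {0..\<eta>} u" "integral {\<eta>..1} u"] left right by simp
  then show "cmod (integral {0..1} (\<lambda>t. of_real (F (?g t)) * cis (\<xi> * t)))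
      \<le> 2 * M / \<bar>\<xi>\<bar> + (M * \<eta> + D)"
    unfolding u_def by (simp add: mult.commute)
qed

lemma decays_refine:
  assumes "0 < p" "p < 1" "0 < q" "q < 1" "unit_path g" "decays M \<delta> D g A E"
  shows "decays M \<delta> D (refine p q g) (4 * A) E"
  using decays_glue[of "1/2" "1/2", OF _ _ _ _ unit_path_glue[OF assms(1-5)] decays_glue[OF assms]]
  by (simp add: refine_def)

lemma decays_refine_concentrated:
  assumes "0 < \<eta>" "\<eta> < 1" "unit_path g"
  shows "decays M \<eta> D (refine \<eta> (1 - \<eta>) g) (4 * M) (M * \<eta> + D)"
  using decays_glue[of "1/2" "1/2", OF _ _ _ _ _ decays_concentrated[OF assms]]
    unit_path_glue[of \<eta> "1 - \<eta>" g] assms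
  by (simp add: refine_def)

lemma decays_cong:
  assumes "\<And>t. t \<in> {0..1} \<Longrightarrow> g t = h t"
  shows "decays M \<delta> D g A E \<longleftrightarrow> decays M \<delta> D h A E"
proof -
  have "integral {0..1} (\<lambda>t. of_real (F (g t)) * cis (\<xi> * t))
      = integral {0..1} (\<lambda>t. of_real (F (h t)) * cis (\<xi> * t))" for F and \<xi> :: real
    by (rule integral_cong) (simp add: assms)
  then show ?thesis
    by (simp add: decays_def)
qed

text \<open>
  The level \<open>n + j\<close> supplies the floor, and each of the \<open>j\<close> levels outside it splits the interval
  into four pieces. The level at which to stop is free: a deeper one has a smaller floor and a larger
  constant in front of \<open>1 / \<bar>\<xi>\<bar>\<close>.
\<close>

lemma (in splitting_ratios) decays_limit_path:
  assumes "q = (\<lambda>n. 1 - p n)"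
  shows "decays M (p (n + j)) D (limit_path n) (4 ^ j * (4 * M)) (M * p (n + j) + D)"
proof (induction j arbitrary: n)
  case 0
  have "decays M (p n) D (refine (p n) (1 - p n) (limit_path (Suc n))) (4 * M) (M * p n + D)"
    by (intro decays_refine_concentrated p unit_path_limit)
  then show ?case
    using decays_cong[OF limit_path_refine[of _ n]] assms by simp
next
  case (Suc j)
  have "decays M (p (n + Suc j)) D (refine (p n) (q n) (limit_path (Suc n)))
      (4 * (4 ^ j * (4 * M))) (M * p (n + Suc j) + D)"
    using decays_refine[OF p q unit_path_limit Suc.IH[of "Suc n"]] by simp
  then show ?case
    using decays_cong[OF limit_path_refine[of _ n]] by simp
qed

section \<open>From paths to homeomorphisms of the circle\<close>

lemma unit_path_surj:
  assumes "unit_path H" "y \<in> {0..1}"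
  shows "\<exists>t\<in>{0..1}. H t = y"
  using IVT'[of H 0 y 1] assms by (auto simp: unit_path_def)

lemma circle_eq_image: "circle = (\<lambda>t. cis (2 * pi * t)) ` {0..1}"
proof -
  have "z \<in> (\<lambda>t. cis (2 * pi * t)) ` {0..1}" if "z \<in> circle" for z
  proof
    have "z = exp (\<i> * of_real (Arg2pi z))"
      using Arg2pi_eq[of z] that by simp
    then show "z = cis (2 * pi * (Arg2pi z / (2 * pi)))"
      by (simp add: cis_conv_exp)
    show "Arg2pi z / (2 * pi) \<in> {0..1}"
      using Arg2pi_ge_0[of z] Arg2pi_lt_2pi[of z] by simp
  qed
  then show ?thesis by auto
qed

lemma cis_2pi_eq_iff:
  assumes "s \<in> {0..1}" "t \<in> {0..1}"
  shows "cis (2 * pi * s) = cis (2 * pi * t) \<longleftrightarrow> s = t \<or> {s, t} = {0, 1}"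
proof
  assume "cis (2 * pi * s) = cis (2 * pi * t)"
  then obtain n :: int where "2 * pi * s = 2 * pi * t + 2 * pi * n"
    using sin_cos_eq_iff[of "2 * pi * s" "2 * pi * t"] by (auto simp: complex_eq_iff)
  then have "2 * pi * s = 2 * pi * (t + n)"
    by (simp add: algebra_simps)
  then have *: "s = t + n"
    by simp
  then have "-1 \<le> real_of_int n" "real_of_int n \<le> 1"
    using assms by auto
  then have "n = -1 \<or> n = 0 \<or> n = 1" by linarith
  then show "s = t \<or> {s, t} = {0, 1}"
    using * assms by auto
qed (auto simp: doubleton_eq_iff)

text \<open>
  The argument is discontinuous at \<open>1\<close>, so the continuity of \<open>h\<close> is obtained from that of its
  composite with the quotient map that identifies the end points of \<open>{0..1}\<close>.
\<close>

lemma circle_homeomorphism_of_unit_path: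
  assumes H: "unit_path H" and inj: "inj_on H {0..1}"
  obtains h g :: "complex \<Rightarrow> complex" where "homeomorphism circle circle h g"
    and "\<And>t. t \<in> {0..1} \<Longrightarrow> h (cis (2 * pi * t)) = cis (2 * pi * H t)"
proof -
  define e where "e t = cis (2 * pi * t)" for t
  define h where "h z = e (H (Arg2pi z / (2 * pi)))" for z
  have e: "circle = e ` {0..1}"
    unfolding e_def by (rule circle_eq_image)
  have e_eq_iff: "e s = e t \<longleftrightarrow> s = t \<or> {s, t} = {0, 1}" if "s \<in> {0..1}" "t \<in> {0..1}" for s t
    unfolding e_def by (rule cis_2pi_eq_iff[OF that])
  have H01: "H 0 = 0" "H 1 = 1" and H_unit: "\<And>t. t \<in> {0..1} \<Longrightarrow> H t \<in> {0..1}"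
    using H by (auto simp: unit_path_def image_subset_iff)
  have conte: "continuous_on S e" for S
    unfolding e_def by (intro continuous_intros)
  have he: "h (e t) = e (H t)" if "t \<in> {0..1}" for t
  proof -
    define s where "s = Arg2pi (e t) / (2 * pi)"
    have s: "s \<in> {0..1}"
      using Arg2pi_ge_0[of "e t"] Arg2pi_lt_2pi[of "e t"] by (simp add: s_def)
    have "e t = exp (\<i> * of_real (Arg2pi (e t)))"
      using Arg2pi_eq[of "e t"] by (simp add: e_def)
    then have "e t = e s"
      by (simp add: e_def s_def cis_conv_exp)
    then have "t = s \<or> {t, s} = {0, 1}"
      using e_eq_iff that s by blast
    then have "e (H s) = e (H t)"
      using H01 by (auto simp: doubleton_eq_iff e_def)
    then show ?thesis
      by (simp add: h_def s_def)
  qed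
  have "continuous_on circle h"
  proof -
    have "quotient_map (top_of_set {0..1}) (top_of_set circle) e"
      by (rule T1_Spaces.continuous_imp_quotient_map)
         (use conte e in \<open>auto simp: compact_space_subtopology Hausdorff_space_subtopology\<close>)
    moreover have "continuous_map (top_of_set {0..1}) euclidean (h \<circ> e)"
    proof -
      have "continuous_on {0..1} (\<lambda>t. e (H t))"
        by (rule continuous_on_compose2[OF conte]) (use H in \<open>auto simp: unit_path_def\<close>)
      then show ?thesis
        using continuous_on_cong[of "{0..1}" "{0..1}" "h \<circ> e" "\<lambda>t. e (H t)"] he by auto
    qed
    ultimately have "continuous_map (top_of_set circle) euclidean h"
      by (rule continuous_compose_quotient_map)
    then show ?thesis by simp
  qed
  moreover have "h ` circle = circle"
  proof -
    have "H ` {0..1} = {0..1}"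
      using unit_path_surj[OF H] H_unit by (auto simp: image_iff) metis
    then have "e ` {0..1} = (\<lambda>t. e (H t)) ` {0..1}"
      by (metis image_image)
    then show ?thesis
      unfolding e image_image using he by simp
  qed
  moreover have "inj_on h circle"
    unfolding e
  proof (rule inj_onI, clarify)
    fix s t :: real assume st: "s \<in> {0..1}" "t \<in> {0..1}" "h (e s) = h (e t)"
    then have "H s = H t \<or> {H s, H t} = {0, 1}"
      using he e_eq_iff H_unit by simp
    then have "s = t \<or> {s, t} = {0, 1}"
      using inj st(1,2) H01 unfolding inj_on_def doubleton_eq_iff
      by (metis atLeastAtMost_iff order_refl zero_le_one)
    then show "e s = e t"
      using e_eq_iff st(1,2) by simp
  qed
  ultimately obtain g where "homeomorphism circle circle h g"
    using homeomorphism_compact[of circle h circle] by auto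
  then show ?thesis
    using that[of h g] he unfolding e_def by blast
qed

section \<open>Convergent series\<close>

text \<open>
  No convergent series converges slowest. The factor is \<open>1 / \<surd>r\<close> with \<open>r\<close> the sequence of tails: the
  difference \<open>\<surd>r n - \<surd>r (Suc n)\<close> equals \<open>d n / (\<surd>r n + \<surd>r (Suc n))\<close>, so twice these telescoping
  differences dominate \<open>d n / \<surd>r n\<close>.
\<close>

lemma du_Bois_Reymond:
  fixes d :: "nat \<Rightarrow> real"
  assumes d: "\<And>n. 0 < d n" and "summable d"
  obtains L where "\<And>n. 0 < L n" "filterlim L at_top sequentially" "summable (\<lambda>n. L n * d n)"
proof -
  define r where "r n = (\<Sum>i. d (i + n))" for n
  have sm: "summable (\<lambda>i. d (i + n))" for n
    using assms(2) by (simp add: summable_iff_shift)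
  have r: "0 < r n" for n
    unfolding r_def by (rule suminf_pos[OF sm]) (rule d)
  have r_Suc: "r n = d n + r (Suc n)" for n
    using suminf_split_head[OF sm[of n]] by (simp add: r_def)
  have r0: "r \<longlonglongrightarrow> 0"
    unfolding r_def by (rule suminf_exist_split2[OF assms(2)])
  then have sqrt0: "(\<lambda>n. sqrt (r n)) \<longlonglongrightarrow> 0"
    using tendsto_real_sqrt by fastforce
  define L where "L n = 1 / sqrt (r n)" for n
  have "L n * d n \<le> 2 * (sqrt (r n) - sqrt (r (Suc n)))" for n
  proof -
    let ?a = "sqrt (r n)" and ?b = "sqrt (r (Suc n))"
    have ab: "0 < ?a" "?b \<le> ?a"
      using r[of n] d[of n] r_Suc[of n] by auto
    have "d n = ?a ^ 2 - ?b ^ 2"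
      using r[of n] r[of "Suc n"] r_Suc[of n] by simp
    also have "\<dots> = (?a - ?b) * (?a + ?b)"
      by (simp add: power2_eq_square algebra_simps)
    also have "\<dots> \<le> (?a - ?b) * (2 * ?a)"
      using ab by (intro mult_left_mono) auto
    finally have "d n \<le> (2 * (?a - ?b)) * ?a"
      by (simp add: mult_ac)
    then show ?thesis
      using ab by (simp add: L_def divide_le_eq)
  qed
  moreover have "summable (\<lambda>n. 2 * (sqrt (r n) - sqrt (r (Suc n))))"
    by (intro summable_mult telescope_summable'[OF sqrt0])
  moreover have "0 < L n" for n
    using r by (simp add: L_def)
  ultimately have "summable (\<lambda>n. L n * d n)"
    by (intro summable_comparison_test'[of _ 0 "\<lambda>n. L n * d n"]) (auto simp: abs_mult d less_imp_le)
  moreover have "filterlim L at_top sequentially"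
    unfolding L_def inverse_eq_divide[symmetric]
    by (rule filterlim_inverse_at_top[OF sqrt0]) (simp add: r)
  ultimately show ?thesis
    using that \<open>\<And>n. 0 < L n\<close> by blast
qed

lemma summable_on_int_even:
  fixes v :: "nat \<Rightarrow> real"
  assumes "summable v" "\<And>n. 0 \<le> v n"
  shows "(\<lambda>k::int. v (nat \<bar>k\<bar>)) summable_on UNIV"
proof -
  have v: "v summable_on UNIV"
    using assms by (intro norm_summable_imp_summable_on) simp
  have "(\<lambda>k::int. v (nat \<bar>k\<bar>)) summable_on range int"
    by (subst summable_on_reindex) (use v in \<open>auto simp: o_def\<close>)
  moreover have "(\<lambda>k::int. v (nat \<bar>k\<bar>)) summable_on (\<lambda>n. - int n) ` {0<..}"
    by (subst summable_on_reindex)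
       (use v in \<open>auto simp: o_def inj_on_def intro: summable_on_subset_banach\<close>)
  moreover have "range int \<inter> (\<lambda>n. - int n) ` {0<..} = {}"
    by auto
  moreover have "range int \<union> (\<lambda>n. - int n) ` {0<..} = UNIV"
  proof -
    have "k \<in> range int \<union> (\<lambda>n. - int n) ` {0<..}" for k :: int
      by (cases k rule: int_cases) (auto simp: image_iff intro: bexI[of _ "Suc _"])
    then show ?thesis by blast
  qed
  ultimately show ?thesis
    using summable_on_Un_disjoint by metis
qed

section \<open>Fourier coefficients over the unit interval\<close>

lemma fourier_coeff_unit_interval:
  assumes "continuous_on {0..1} (\<lambda>s. x (cis (2 * pi * s)))"
  shows "fourier_coeff x k
      = integral {0..1} (\<lambda>s. x (cis (2 * pi * s)) * cis (- (2 * pi * of_int k) * s))"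
    and "circle_integrable x"
proof -
  define u where "u t = x (cis t) * cis (- of_int k * t)" for t
  have "continuous_on {0..2*pi} (\<lambda>t. x (cis (2 * pi * (t / (2 * pi)))))"
    by (rule continuous_on_compose2[OF assms]) (auto intro!: continuous_intros)
  then have x: "continuous_on {0..2*pi} (\<lambda>t. x (cis t))"
    by simp
  then show "circle_integrable x"
    unfolding circle_integrable_def by (rule absolutely_integrable_continuous_real)
  from x have u: "continuous_on {0..2*pi} u"
    unfolding u_def by (intro continuous_intros)
  have "x (cis t) * exp (- \<i> * of_int k * of_real t) = u t" for t
    by (simp add: u_def cis_conv_exp mult_ac)
  then have "fourier_coeff x k = 1 / (2 * pi) * integral {0..2*pi} u"
    unfolding fourier_coeff_def
    using set_lebesgue_integral_eq_integral(2)[OF absolutely_integrable_continuous_real[OF u]]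
    by simp
  also have "integral {0..2*pi} u = (2 * pi - 0) *\<^sub>R integral {0..1} (\<lambda>s. u (0 + (2 * pi - 0) * s))"
    by (rule integral_rescale_unit[OF _ u]) simp
  finally show "fourier_coeff x k
      = integral {0..1} (\<lambda>s. x (cis (2 * pi * s)) * cis (- (2 * pi * of_int k) * s))"
    by (simp add: u_def scaleR_conv_of_real mult_ac)
qed

section \<open>Functions with a given modulus of continuity\<close>

lemma H_class_oscillation:
  assumes f: "f \<in> H_class \<omega>" and \<omega>: "mono_on {0..} \<omega>" "\<omega> 0 = 0"
  obtains C d where "0 \<le> C" "0 < d"
    "\<And>\<delta> s t. 0 < \<delta> \<Longrightarrow> \<delta> < d \<Longrightarrow> \<bar>s - t\<bar> < \<delta> \<Longrightarrow> \<bar>f (cis s) - f (cis t)\<bar> \<le> C * \<omega> \<delta>"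
proof -
  obtain C where "\<forall>\<^sub>F \<delta> in at_right 0. modulus_of_continuity \<delta> f \<le> ereal (C * \<omega> \<delta>)"
    using f by (auto simp: H_class_def)
  then obtain d where d: "0 < d"
    "\<And>\<delta>. 0 < \<delta> \<Longrightarrow> \<delta> < d \<Longrightarrow> modulus_of_continuity \<delta> f \<le> ereal (C * \<omega> \<delta>)"
    unfolding eventually_at_right_field by auto
  have "\<bar>f (cis s) - f (cis t)\<bar> \<le> \<bar>C\<bar> * \<omega> \<delta>" if "0 < \<delta>" "\<delta> < d" "\<bar>s - t\<bar> < \<delta>" for \<delta> s t
  proof -
    have "ereal \<bar>f (cis s) - f (cis t)\<bar> \<le> modulus_of_continuity \<delta> f"
      unfolding modulus_of_continuity_def by (rule SUP_upper2[of "(s, t)"]) (use that in auto)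
    also have "\<dots> \<le> ereal (C * \<omega> \<delta>)"
      by (rule d(2)[OF that(1,2)])
    finally have "\<bar>f (cis s) - f (cis t)\<bar> \<le> C * \<omega> \<delta>"
      by simp
    moreover have "0 \<le> \<omega> \<delta>"
      using mono_onD[OF \<omega>(1), of 0 \<delta>] \<omega>(2) that(1) by simp
    ultimately show ?thesis
      by (meson abs_ge_self mult_right_mono order_trans)
  qed
  then show ?thesis
    using that[of "\<bar>C\<bar>" d] d(1) by simp
qed

lemma continuous_at_0_small:
  fixes \<omega> :: "real \<Rightarrow> real"
  assumes "continuous_on {0..} \<omega>" "\<omega> 0 = 0" "0 < e"
  obtains \<eta> where "0 < \<eta>" "\<eta> \<le> 1/2" "\<eta> \<le> e" "\<omega> (8 * \<eta>) \<le> e"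
proof -
  obtain d where d: "0 < d" "\<And>x. 0 \<le> x \<Longrightarrow> \<bar>x\<bar> < d \<Longrightarrow> \<bar>\<omega> x\<bar> < e"
    using assms unfolding continuous_on_iff dist_real_def by (metis atLeast_iff diff_zero order_refl)
  show ?thesis
  proof (rule that[of "min (1/2) (min e (d / 16))"])
    show "\<omega> (8 * min (1/2) (min e (d / 16))) \<le> e"
      using d(2)[of "8 * min (1/2) (min e (d / 16))"] d(1) assms(3) by linarith
  qed (use d(1) assms(3) in auto)
qed

text \<open>
  The factor \<open>8\<close> exceeds the factor \<open>2\<pi>\<close> between arc length and the parameter in \<open>{0..1}\<close>, which
  also turns the non-strict bound in \<^const>\<open>tame\<close> into the strict one in the modulus of continuity.
\<close>

lemma H_class_tame:
  assumes f: "f \<in> H_class \<omega>" and \<omega>: "mono_on {0..} \<omega>" "continuous_on {0..} \<omega>" "\<omega> 0 = 0"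
  obtains M C d where "0 \<le> M" "0 \<le> C" "0 < d"
    "\<And>\<eta>. 0 < \<eta> \<Longrightarrow> \<eta> < d \<Longrightarrow> tame M \<eta> (C * \<omega> (8 * \<eta>)) (\<lambda>s. f (cis (2 * pi * s)))"
proof -
  define F where "F s = f (cis (2 * pi * s))" for s
  obtain C d where C: "0 \<le> C" and d: "0 < d" and
    osc: "\<And>\<delta> s t. 0 < \<delta> \<Longrightarrow> \<delta> < d \<Longrightarrow> \<bar>s - t\<bar> < \<delta> \<Longrightarrow> \<bar>f (cis s) - f (cis t)\<bar> \<le> C * \<omega> \<delta>"
    using H_class_oscillation[OF f \<omega>(1,3)] by metis
  have oscF: "\<bar>F s - F t\<bar> \<le> C * \<omega> (8 * \<eta>)" if "0 < \<eta>" "\<eta> < d / 8" "\<bar>s - t\<bar> \<le> \<eta>" for \<eta> s t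
  proof -
    have "\<bar>2 * pi * s - 2 * pi * t\<bar> = 2 * pi * \<bar>s - t\<bar>"
      by (simp add: abs_mult flip: right_diff_distrib)
    also have "\<dots> \<le> 2 * pi * \<eta>"
      using that(3) by simp
    also have "\<dots> < 8 * \<eta>"
      using that(1) pi_less_4 by simp
    finally show ?thesis
      unfolding F_def using osc[of "8 * \<eta>"] that(1,2) by simp
  qed
  have contF: "continuous_on {0..1} F"
    unfolding continuous_on_iff
  proof (intro ballI allI impI)
    fix s e :: real assume "0 < e"
    then have "0 < e / (C + 1)"
      using C by simp
    from continuous_at_0_small[OF \<omega>(2,3) this]
    obtain \<eta>0 where \<eta>0: "0 < \<eta>0" "\<omega> (8 * \<eta>0) \<le> e / (C + 1)" by metis
    define \<eta> where "\<eta> = min \<eta>0 (d / 16)"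
    have \<eta>: "0 < \<eta>" "\<eta> < d / 8" "\<eta> \<le> \<eta>0"
      using \<eta>0 d by (auto simp: \<eta>_def)
    have "\<omega> (8 * \<eta>) \<le> \<omega> (8 * \<eta>0)"
      by (rule mono_onD[OF \<omega>(1)]) (use \<eta> in auto)
    then have "C * \<omega> (8 * \<eta>) \<le> C * (e / (C + 1))"
      using \<eta>0(2) C by (intro mult_left_mono) auto
    also have "\<dots> < e"
      using C \<open>0 < e\<close> by (simp add: field_simps)
    finally have small: "C * \<omega> (8 * \<eta>) < e" .
    have "dist (F t) (F s) < e" if "dist t s < \<eta>" for t
      using oscF[OF \<eta>(1,2), of t s] that small by (simp add: dist_real_def)
    then show "\<exists>d>0. \<forall>t\<in>{0..1}. dist t s < d \<longrightarrow> dist (F t) (F s) < e"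
      using \<eta>(1) by blast
  qed
  then have "bounded (F ` {0..1})"
    by (intro compact_imp_bounded compact_continuous_image) auto
  then obtain M where M: "\<And>s. s \<in> {0..1} \<Longrightarrow> \<bar>F s\<bar> \<le> M"
    unfolding bounded_iff by (auto simp del: atLeastAtMost_iff)
  show ?thesis
  proof (rule that[of M C "d / 8"])
    show "0 \<le> M"
      using M[of 0] by simp
    show "tame M \<eta> (C * \<omega> (8 * \<eta>)) (\<lambda>s. f (cis (2 * pi * s)))" if "0 < \<eta>" "\<eta> < d / 8" for \<eta>
      using contF M oscF that unfolding tame_def F_def by blast
  qed (use C d in auto)
qed

section \<open>Choosing the refinement level for each frequency\<close>

lemma growing_thresholds:
  assumes "filterlim L at_top sequentially"
  obtains K :: "nat \<Rightarrow> nat" where "\<And>N. N < K N" "\<And>N k. K N \<le> k \<Longrightarrow> 4 ^ N \<le> (L (k - 1) :: real)"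
proof -
  have "\<exists>K>N. \<forall>k\<ge>K. 4 ^ N \<le> L (k - 1)" for N
  proof -
    have "eventually (\<lambda>k. 4 ^ N \<le> L k) sequentially"
      using assms by (simp add: filterlim_at_top)
    then obtain k0 where "\<And>k. k0 \<le> k \<Longrightarrow> 4 ^ N \<le> L k"
      by (auto simp: eventually_sequentially)
    then show ?thesis
      by (intro exI[of _ "Suc (max k0 N)"]) auto
  qed
  then show ?thesis
    using that by metis
qed

text \<open>
  For a frequency \<open>k\<close> one stops at the first admissible level whose floor is of order \<open>1 / k\<close>. Then either
  this is the level \<open>n0\<close>, or \<open>k\<close> has passed the preceding threshold and \<open>L\<close> controls the constant.
\<close>

lemma threshold_stage:
  fixes K :: "nat \<Rightarrow> nat" and k n0 :: nat
  assumes "\<And>N. N < K N" "\<And>N k. K N \<le> k \<Longrightarrow> 4 ^ N \<le> (L (k - 1) :: real)"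
    and "0 \<le> L (k - 1)"
  obtains N where "n0 \<le> N" "k < K (Suc N)" "4 ^ N \<le> 4 ^ n0 + L (k - 1)"
proof -
  let ?P = "\<lambda>N. n0 \<le> N \<and> k < K (Suc N)"
  define N where "N = (LEAST N. ?P N)"
  have "k < K (Suc (max n0 k))"
    using assms(1)[of "Suc (max n0 k)"] by linarith
  then have "?P (max n0 k)"
    by simp
  then have N: "?P N"
    unfolding N_def by (rule LeastI)
  have "4 ^ N \<le> 4 ^ n0 + L (k - 1)"
  proof (cases "N = n0")
    case True
    then show ?thesis using assms(3) by simp
  next
    case False
    then obtain N' where N': "N = Suc N'" "n0 \<le> N'"
      using N by (cases N) auto
    then have "\<not> ?P N'"
      using not_less_Least[of N' ?P] by (simp add: N_def)
    then have "K N \<le> k"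
      using N' by simp
    then have "4 ^ N \<le> L (k - 1)"
      by (rule assms(2))
    then show ?thesis
      by (simp add: add_increasing)
  qed
  then show ?thesis
    using that N by blast
qed

section \<open>A change of variable for the whole class\<close>

theorem corollary2:
  fixes \<epsilon> :: "nat \<Rightarrow> real"
  assumes "\<And>n. \<epsilon> n > 0"
    and "\<epsilon> \<longlonglongrightarrow> 0"
    and "summable (\<lambda>n. \<epsilon> (Suc n) / real (Suc n))"
  shows "\<forall>\<omega> :: real \<Rightarrow> real.
    mono_on {0..} \<omega> \<and> continuous_on {0..} \<omega> \<and> \<omega> 0 = 0 \<longrightarrow>
    (\<exists>h g :: complex \<Rightarrow> complex. homeomorphism circle circle h g \<and>
      (\<forall>f \<in> H_class \<omega>. complex_of_real \<circ> (f \<circ> h) \<in> A_space \<epsilon>))"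
proof (intro allI impI, elim conjE)
  fix \<omega> :: "real \<Rightarrow> real"
  assume \<omega>: "mono_on {0..} \<omega>" "continuous_on {0..} \<omega>" "\<omega> 0 = 0"
  define d where "d n = \<epsilon> (Suc n) / real (Suc n)" for n
  have d: "0 < d n" for n
    using assms(1) by (simp add: d_def)
  have summ_d: "summable d"
    unfolding d_def by (rule assms(3))
  \<comment> \<open>The room between a floor of size 1/k and the admissible decay: the coefficients may be
    as large as L(k - 1)/k.\<close>
  obtain L where L: "\<And>n. 0 < L n" "filterlim L at_top sequentially" "summable (\<lambda>n. L n * d n)"
    using du_Bois_Reymond[OF d summ_d] by metis
  obtain K :: "nat \<Rightarrow> nat" where K: "\<And>N. N < K N" "\<And>N k. K N \<le> k \<Longrightarrow> 4 ^ N \<le> L (k - 1)"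
    using growing_thresholds[OF L(2)] by metis
  have K_pos: "0 < 1 / real (K (Suc N))" for N
    using K(1)[of "Suc N"] by simp
  \<comment> \<open>The floor at level N must be of order 1/k for all k up to the next threshold, while the
    thresholds depend only on L; so the ratios can be chosen after them.\<close>
  have "\<exists>\<eta>. 0 < \<eta> \<and> \<eta> \<le> 1/2 \<and> \<eta> \<le> 1 / K (Suc N) \<and> \<omega> (8 * \<eta>) \<le> 1 / K (Suc N)" for N
    using continuous_at_0_small[OF \<omega>(2,3) K_pos] by metis
  then obtain p :: "nat \<Rightarrow> real" where ratio: "\<And>N. 0 < p N" "\<And>N. p N \<le> 1/2"
      "\<And>N. p N \<le> 1 / K (Suc N)" "\<And>N. \<omega> (8 * p N) \<le> 1 / K (Suc N)"
    by metis
  have p1: "p N < 1" for N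
    using ratio(2)[of N] by simp
  have p_lim: "p \<longlonglongrightarrow> 0"
  proof (rule tendsto_sandwich[OF _ _ tendsto_const])
    show "(\<lambda>N. 1 / real (Suc N)) \<longlonglongrightarrow> 0"
      using LIMSEQ_inverse_real_of_nat by (simp add: inverse_eq_divide)
    have "p N \<le> 1 / real (Suc N)" for N
    proof -
      have "1 / real (K (Suc N)) \<le> 1 / real (Suc N)"
        using K(1)[of "Suc N"] by (intro divide_left_mono) auto
      then show ?thesis using ratio(3)[of N] by linarith
    qed
    then show "\<forall>\<^sub>F N in sequentially. p N \<le> 1 / real (Suc N)"
      by simp
  qed (use ratio(1) in \<open>simp add: less_imp_le\<close>)
  interpret splitting_ratios p "\<lambda>n. 1 - p n"
    by unfold_locales (use ratio(1) p1 in auto)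
  let ?H = "limit_path 0"
  obtain h g where hom: "homeomorphism circle circle h g"
    and h: "\<And>t. t \<in> {0..1} \<Longrightarrow> h (cis (2 * pi * t)) = cis (2 * pi * ?H t)"
    using circle_homeomorphism_of_unit_path[OF unit_path_limit inj_on_limit_path] by metis
  have "complex_of_real \<circ> (f \<circ> h) \<in> A_space \<epsilon>" if f: "f \<in> H_class \<omega>" for f
  proof -
    let ?x = "complex_of_real \<circ> (f \<circ> h)"
    define F where "F s = f (cis (2 * pi * s))" for s
    obtain M C d0 where MC: "0 \<le> M" "0 \<le> C" and d0: "0 < d0"
      and tame: "\<And>\<eta>. 0 < \<eta> \<Longrightarrow> \<eta> < d0 \<Longrightarrow> tame M \<eta> (C * \<omega> (8 * \<eta>)) F"
      using H_class_tame[OF f \<omega>] unfolding F_def by metis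
    \<comment> \<open>The modulus of f is controlled at small scales only, which excludes finitely many levels.\<close>
    obtain n0 where n0: "\<And>N. n0 \<le> N \<Longrightarrow> p N < d0"
      using order_tendstoD(2)[OF p_lim d0] by (auto simp: eventually_sequentially)
    have xF: "?x (cis (2 * pi * s)) = of_real (F (?H s))" if "s \<in> {0..1}" for s
      using h[OF that] by (simp add: F_def)
    have "continuous_on {0..1} F"
      using tame[OF ratio(1) n0[OF order_refl]] by (simp add: tame_def)
    then have "continuous_on {0..1} (\<lambda>s. F (?H s))"
      by (rule continuous_on_compose2) (use unit_path_limit[of 0] in \<open>auto simp: unit_path_def\<close>)
    then have contF: "continuous_on {0..1} (\<lambda>s. complex_of_real (F (?H s)))"
      by (intro continuous_intros)
    have cont: "continuous_on {0..1} (\<lambda>s. ?x (cis (2 * pi * s)))"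
      by (rule continuous_on_eq[OF contF]) (simp only: xF)
    have coeff: "fourier_coeff ?x k
        = integral {0..1} (\<lambda>s. of_real (F (?H s)) * cis (- (2 * pi * of_int k) * s))" for k
      unfolding fourier_coeff_unit_interval(1)[OF cont] by (rule integral_cong) (use xF in simp)
    have stage: "cmod (fourier_coeff ?x k) \<le> 4 ^ N * (4 * M) / \<bar>k\<bar> + (M + C) / K (Suc N)"
      if "k \<noteq> 0" "n0 \<le> N" for k N
    proof -
      have "- (2 * pi * real_of_int k) \<noteq> 0"
        using that(1) by simp
      moreover have "decays M (p N) (C * \<omega> (8 * p N)) ?H (4 ^ N * (4 * M)) (M * p N + C * \<omega> (8 * p N))"
        using decays_limit_path[of M 0 N "C * \<omega> (8 * p N)"] by simp
      ultimately have "cmod (fourier_coeff ?x k)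
          \<le> 4 ^ N * (4 * M) / \<bar>- (2 * pi * of_int k)\<bar> + (M * p N + C * \<omega> (8 * p N))"
        unfolding coeff decays_def using tame[OF ratio(1) n0[OF that(2)]] by blast
      also have "4 ^ N * (4 * M) / \<bar>- (2 * pi * of_int k)\<bar> \<le> 4 ^ N * (4 * M) / \<bar>k\<bar>"
      proof (rule divide_left_mono)
        have "1 * \<bar>real_of_int k\<bar> \<le> (2 * pi) * \<bar>real_of_int k\<bar>"
          using pi_gt3 by (intro mult_right_mono) auto
        then show "\<bar>k\<bar> \<le> \<bar>- (2 * pi * real_of_int k)\<bar>"
          by (simp add: abs_mult)
      qed (use MC that(1) in auto)
      also have "M * p N + C * \<omega> (8 * p N) \<le> M * (1 / K (Suc N)) + C * (1 / K (Suc N))"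
        using MC ratio(3,4) by (intro add_mono mult_left_mono) auto
      finally show ?thesis
        by (simp add: add_divide_distrib)
    qed
    define a where "a = 4 ^ n0 * (4 * M) + (M + C)"
    have bound: "cmod (fourier_coeff ?x k) * \<epsilon> (nat \<bar>k\<bar>)
        \<le> (a + 4 * M * L (nat \<bar>k\<bar> - 1)) * d (nat \<bar>k\<bar> - 1)" if "k \<noteq> 0" for k
    proof -
      define j where "j = nat \<bar>k\<bar>"
      have j: "0 < real j" "real_of_int \<bar>k\<bar> = real j"
        using that by (auto simp: j_def)
      obtain N where N: "n0 \<le> N" "j < K (Suc N)" "4 ^ N \<le> 4 ^ n0 + L (j - 1)"
        using threshold_stage[of K L j n0] K L(1) less_imp_le by metis
      have "4 ^ N * (4 * M) / j \<le> (4 ^ n0 + L (j - 1)) * (4 * M) / j"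
        using N(3) MC(1) by (intro divide_right_mono mult_right_mono) auto
      moreover have "(M + C) / K (Suc N) \<le> (M + C) / j"
        using N(2) MC j(1) by (intro divide_left_mono) auto
      ultimately have "cmod (fourier_coeff ?x k)
          \<le> (4 ^ n0 + L (j - 1)) * (4 * M) / j + (M + C) / j"
        using stage[OF that N(1)] unfolding j(2) by linarith
      also have "\<dots> = (a + 4 * M * L (j - 1)) / j"
        by (simp add: a_def add_divide_distrib algebra_simps)
      finally have "cmod (fourier_coeff ?x k) * \<epsilon> j \<le> (a + 4 * M * L (j - 1)) / j * \<epsilon> j"
        using assms(1)[of j] by (intro mult_right_mono) auto
      also have "\<dots> = (a + 4 * M * L (j - 1)) * d (j - 1)"
        using j(1) by (simp add: d_def)
      finally show ?thesis
        by (simp add: j_def)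
    qed
    define v where "v j = (if j = 0 then cmod (fourier_coeff ?x 0) * \<epsilon> 0
        else (a + 4 * M * L (j - 1)) * d (j - 1))" for j
    have "summable (\<lambda>j. a * d j + 4 * M * (L j * d j))"
      by (intro summable_add summable_mult summ_d L(3))
    then have "summable (\<lambda>j. v (Suc j))"
      by (simp add: v_def algebra_simps)
    then have "summable v"
      by (simp add: summable_Suc_iff)
    moreover have "0 \<le> v j" for j
      using MC assms(1) d L(1) by (simp add: v_def a_def less_imp_le)
    ultimately have "(\<lambda>k::int. v (nat \<bar>k\<bar>)) summable_on UNIV"
      by (rule summable_on_int_even)
    then have "(\<lambda>k::int. cmod (fourier_coeff ?x k) * \<epsilon> (nat \<bar>k\<bar>)) summable_on UNIV"
    proof (rule summable_on_comparison_test)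
      show "cmod (fourier_coeff ?x k) * \<epsilon> (nat \<bar>k\<bar>) \<le> v (nat \<bar>k\<bar>)" for k
        using bound[of k] by (cases "k = 0") (auto simp: v_def)
      show "0 \<le> cmod (fourier_coeff ?x k) * \<epsilon> (nat \<bar>k\<bar>)" for k
        using assms(1) by (simp add: less_imp_le)
    qed
    then show ?thesis
      using fourier_coeff_unit_interval(2)[OF cont] unfolding A_space_def by blast
  qed
  then show "\<exists>h g :: complex \<Rightarrow> complex. homeomorphism circle circle h g \<and>
      (\<forall>f \<in> H_class \<omega>. complex_of_real \<circ> (f \<circ> h) \<in> A_space \<epsilon>)"
    using hom by blast
qed

end
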